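(* Let $\Gamma$ be a finite simple graph with maximum degree $\Delta$ and isoperimetric number ${\bf i}(\Gamma)$, and let $k$ be an integer. (i) If $\Gamma$ is partitionable into global defensive $k$-alliances, then $\psi_k^{gd}(\Gamma)\le \Delta+1-{\bf i}(\Gamma)-k$. (ii) If $\Gamma$ is partitionable into defensive $k$-alliances, then $a_k^d(\Gamma)\ge {\bf i}(\Gamma)+k+1$.
   Context: Let $\Gamma=(V,E)$ be a finite simple graph of order $n=|V|$, with minimum degree $\delta$ and maximum degree $\Delta$. For $X\subseteq V$ and $v\in V$, $\delta_X(v)$ is the number of neighbors of $v$ in $X$; $\bar S=V\setminus S$. A nonempty set $S\subseteq V$ is a defensive $k$-alliance if $\delta_S(v)\ge\delta_{\bar S}(v)+k$ for every $v\in S$. It is global if moreover it is a dominating set, i.e. $\delta_S(u)>0$ for every $u\in\bar S$. $a_k^d(\Gamma)$ is the minimum cardinality of a defensive $k$-alliance in $\Gamma$ (when one exists). For $k\in\{-\Delta,\dots,\delta\}$, $\psi_k^{d}(\Gamma)$ (resp. $\psi_k^{gd}(\Gamma)$) is the maximum number of sets in a partition of $V$ such that each set is a defensive (resp. global defensive) $k$-alliance. $\Gamma$ is partitionable into defensive (resp. global defensive) $k$-alliances if $\psi_k^{d}(\Gamma)\ge 2$ (resp. $\psi_k^{gd}(\Gamma)\ge2$). The isoperimetric number is ${\bf i}(\Gamma)=\min\left\{\frac{\sum_{v\in S}\delta_{\bar S}(v)}{|S|}: \emptyset\ne S\subset V,\ |S|\le \frac n2\right\}$. *)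

theory Defs
  imports Complex_Main "HOL-Library.Disjoint_Sets" "Graph_Theory.Pair_Digraph"
begin

text \<open>
  A finite simple graph is a \<open>pair_graph\<close>: a finite vertex set \<open>pverts G\<close> with a symmetric,
  irreflexive adjacency relation \<open>parcs G\<close>. Each edge is thus present as two opposite arcs, so
  \<open>out_degree\<close> is the usual degree of a vertex.
\<close>

definition max_degree :: "'a pair_pre_digraph \<Rightarrow> nat" where
  "max_degree G = Max (out_degree G ` pverts G)"

definition nbrs_in :: "'a pair_pre_digraph \<Rightarrow> 'a set \<Rightarrow> 'a \<Rightarrow> nat" where
  "nbrs_in G X v = card {u \<in> X. (v, u) \<in> parcs G}"

definition defensive_alliance :: "'a pair_pre_digraph \<Rightarrow> int \<Rightarrow> 'a set \<Rightarrow> bool" where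
  "defensive_alliance G k S \<longleftrightarrow> S \<noteq> {} \<and> S \<subseteq> pverts G \<and>
     (\<forall>v\<in>S. int (nbrs_in G S v) \<ge> int (nbrs_in G (pverts G - S) v) + k)"

definition dominating_set :: "'a pair_pre_digraph \<Rightarrow> 'a set \<Rightarrow> bool" where
  "dominating_set G S \<longleftrightarrow> S \<subseteq> pverts G \<and> (\<forall>u\<in>pverts G - S. nbrs_in G S u > 0)"

definition global_defensive_alliance :: "'a pair_pre_digraph \<Rightarrow> int \<Rightarrow> 'a set \<Rightarrow> bool" where
  "global_defensive_alliance G k S \<longleftrightarrow> defensive_alliance G k S \<and> dominating_set G S"

text \<open>
  This is \<open>Min {}\<close>, hence unspecified, if the graph has no defensive alliance for \<open>k\<close>.
\<close>
definition defensive_alliance_number :: "'a pair_pre_digraph \<Rightarrow> int \<Rightarrow> nat" where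
  "defensive_alliance_number G k = Min {card S |S. defensive_alliance G k S}"

text \<open>
  On \<open>nat\<close>, \<open>Sup\<close> of a nonempty finite set is its maximum, and \<open>Sup {} = 0\<close>. So the two partition
  numbers are 0, rather than unspecified, when no partition of the required kind exists; a graph
  without such a partition is therefore not partitionable.
\<close>
definition psi_d :: "'a pair_pre_digraph \<Rightarrow> int \<Rightarrow> nat" where
  "psi_d G k = Sup {card P |P. partition_on (pverts G) P \<and> (\<forall>S\<in>P. defensive_alliance G k S)}"

definition psi_gd :: "'a pair_pre_digraph \<Rightarrow> int \<Rightarrow> nat" where
  "psi_gd G k =
     Sup {card P |P. partition_on (pverts G) P \<and> (\<forall>S\<in>P. global_defensive_alliance G k S)}"

definition partitionable_d :: "'a pair_pre_digraph \<Rightarrow> int \<Rightarrow> bool" where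
  "partitionable_d G k \<longleftrightarrow> psi_d G k \<ge> 2"

definition partitionable_gd :: "'a pair_pre_digraph \<Rightarrow> int \<Rightarrow> bool" where
  "partitionable_gd G k \<longleftrightarrow> psi_gd G k \<ge> 2"

text \<open>
  The minimum ranges over a nonempty set exactly when the graph has at least two vertices.
\<close>
definition isoperimetric_number :: "'a pair_pre_digraph \<Rightarrow> real" where
  "isoperimetric_number G =
     Min {real (\<Sum>v\<in>S. nbrs_in G (pverts G - S) v) / real (card S) |S.
            S \<noteq> {} \<and> S \<subset> pverts G \<and> real (card S) \<le> real (card (pverts G)) / 2}"

end

theory Submission
  imports Defs
begin

text \<open>
  Both bounds come from one vertex. Suppose that \<open>V\<close> is partitioned into at least two defensive
  \<open>k\<close>-alliances. The smallest of them has at most half of the vertices, so it competes in the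
  minimum that defines the isoperimetric number \<open>i\<close>
  (\<open>small_part_of_partition\<close>). For every nonempty set \<open>S\<close> of at most half of the vertices, the
  average number of neighbours outside \<open>S\<close> is at least \<open>i\<close>, so some \<open>v \<in> S\<close> has at least \<open>i\<close>
  neighbours outside \<open>S\<close> (\<open>exists_vertex_isoperimetric\<close>). If \<open>S\<close> is a defensive
  \<open>k\<close>-alliance, this \<open>v\<close> has at least \<open>i + k\<close> neighbours inside \<open>S\<close>.

  For the lower bound on the alliance number, take for \<open>S\<close> an alliance of minimum size:
  \<open>v\<close> has at most \<open>|S| - 1\<close> neighbours in \<open>S\<close>, since it is not adjacent to itself.

  For the upper bound on the global partition number, take for \<open>S\<close> a small part of a partition
  into \<open>r\<close> global alliances: each of the other \<open>r - 1\<close> parts dominates \<open>v\<close>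
  (\<open>dominating_partition_nbrs_outside\<close>), so \<open>v\<close> has at least \<open>r - 1\<close> neighbours outside \<open>S\<close> on
  top of the \<open>i + k\<close> inside, and its degree is at least \<open>i + k + r - 1\<close>.
\<close>

lemma finite_nbrs:
  assumes "pair_graph G"
  shows "finite {u \<in> X. (v, u) \<in> parcs G}"
proof -
  interpret pair_graph G by fact
  have "{u \<in> X. (v, u) \<in> parcs G} \<subseteq> snd ` parcs G" by force
  then show ?thesis by (rule finite_subset) (simp add: pair_finite_arcs)
qed

lemma degree_eq_nbrs_in_add_nbrs_outside:
  assumes "pair_graph G" "S \<subseteq> pverts G"
  shows "out_degree G v = nbrs_in G S v + nbrs_in G (pverts G - S) v"
proof -
  interpret pair_graph G by fact
  have "out_arcs G v = Pair v ` {u \<in> pverts G. (v, u) \<in> parcs G}"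
    by (auto simp: out_arcs_def dest: in_arcsD2)
  then have "out_degree G v = card {u \<in> pverts G. (v, u) \<in> parcs G}"
    by (simp add: out_degree_def card_image inj_on_def)
  also have "{u \<in> pverts G. (v, u) \<in> parcs G} =
      {u \<in> S. (v, u) \<in> parcs G} \<union> {u \<in> pverts G - S. (v, u) \<in> parcs G}"
    using assms(2) by auto
  also have "card \<dots> = nbrs_in G S v + nbrs_in G (pverts G - S) v"
    unfolding nbrs_in_def by (intro card_Un_disjoint finite_nbrs assms(1)) auto
  finally show ?thesis .
qed

lemma degree_le_max_degree:
  assumes "pair_graph G" "v \<in> pverts G"
  shows "out_degree G v \<le> max_degree G"
proof -
  interpret pair_graph G by fact
  show ?thesis unfolding max_degree_def using assms(2) pair_finite_verts by simp
qed

lemma nbrs_in_less_card: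
  assumes "pair_graph G" "finite S" "v \<in> S"
  shows "nbrs_in G S v < card S"
proof -
  interpret pair_graph G by fact
  have "(v, v) \<notin> parcs G" using pair_no_loops by fastforce
  then have "{u \<in> S. (v, u) \<in> parcs G} \<subset> S" using assms(3) by blast
  then show ?thesis unfolding nbrs_in_def by (intro psubset_card_mono assms(2))
qed

text \<open>
  The set \<open>S\<close> competes in the minimum, so the average of its outside degrees is at least the
  isoperimetric number, and some term reaches the average.
\<close>
lemma exists_vertex_isoperimetric:
  assumes "finite (pverts G)" "S \<noteq> {}" "S \<subseteq> pverts G" "2 * card S \<le> card (pverts G)"
  obtains v where "v \<in> S" "isoperimetric_number G \<le> real (nbrs_in G (pverts G - S) v)"
proof -
  let ?cut = "\<lambda>S. \<Sum>v\<in>S. nbrs_in G (pverts G - S) v"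
  let ?Q = "{real (?cut S) / real (card S) |S.
      S \<noteq> {} \<and> S \<subset> pverts G \<and> real (card S) \<le> real (card (pverts G)) / 2}"
  have pos: "card S > 0"
    using assms(1-3) by (meson card_gt_0_iff finite_subset)
  then have "S \<subset> pverts G" using assms(3,4) by auto
  moreover have "real (card S) \<le> real (card (pverts G)) / 2" using assms(4) by simp
  ultimately have "real (?cut S) / real (card S) \<in> ?Q" using assms(2) by blast
  moreover have "finite ?Q"
    by (rule finite_subset[of _ "(\<lambda>S. real (?cut S) / real (card S)) ` Pow (pverts G)"])
      (use assms(1) in auto)
  ultimately have "isoperimetric_number G \<le> real (?cut S) / real (card S)"
    unfolding isoperimetric_number_def by (rule Min_le[rotated])
  then have le: "isoperimetric_number G * real (card S) \<le> real (?cut S)"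
    using pos by (simp add: field_simps)
  have "\<exists>v\<in>S. isoperimetric_number G \<le> real (nbrs_in G (pverts G - S) v)"
  proof (rule ccontr)
    assume "\<not> ?thesis"
    then have "(\<Sum>v\<in>S. real (nbrs_in G (pverts G - S) v)) < (\<Sum>v\<in>S. isoperimetric_number G)"
      using assms(1-3) by (intro sum_strict_mono) (auto intro: finite_subset)
    with le show False by (simp add: mult.commute)
  qed
  then show thesis using that by blast
qed

lemma small_part_of_partition:
  assumes "finite V" "partition_on V P" "card P \<ge> 2"
  obtains S where "S \<in> P" "2 * card S \<le> card V"
proof -
  obtain S T where ST: "S \<in> P" "T \<in> P" "S \<noteq> T"
    using assms(3) by (metis card_le_Suc0_iff_eq card.infinite not_less_eq_eq numeral_2_eq_2 zero_le)
  then have sub: "S \<subseteq> V" "T \<subseteq> V" using assms(2) by (auto simp: partition_on_def)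
  have "S \<inter> T = {}" using ST assms(2) by (auto simp: partition_on_def disjoint_def)
  then have "card S + card T = card (S \<union> T)"
    using sub assms(1) by (simp add: card_Un_disjoint finite_subset)
  also have "\<dots> \<le> card V" using sub assms(1) by (simp add: card_mono)
  finally have "2 * card S \<le> card V \<or> 2 * card T \<le> card V" by linarith
  then show thesis using ST that by blast
qed

text \<open>
  Every other part contains a neighbour of \<open>v\<close>, and neighbours in different parts are distinct.
\<close>
lemma dominating_partition_nbrs_outside:
  assumes G: "pair_graph G" and P: "partition_on (pverts G) P"
    and dom: "\<And>T. T \<in> P \<Longrightarrow> dominating_set G T"
    and S: "S \<in> P" and v: "v \<in> S"
  shows "card P \<le> nbrs_in G (pverts G - S) v + 1"
proof -
  interpret pair_graph G by fact
  have fin: "finite P" using P pair_finite_verts by (rule finite_elements[rotated])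
  have disj: "T \<inter> T' = {}" if "T \<in> P" "T' \<in> P" "T \<noteq> T'" for T T'
    using P that by (auto simp: partition_on_def disjoint_def)
  have sub: "T \<subseteq> pverts G" if "T \<in> P" for T
    using P that by (auto simp: partition_on_def)
  have "\<exists>u\<in>T. (v, u) \<in> parcs G" if T: "T \<in> P - {S}" for T
  proof -
    have "v \<in> pverts G - T" using disj[of S T] sub[OF S] S T v by auto
    then have "nbrs_in G T v > 0" using dom T by (auto simp: dominating_set_def)
    then show ?thesis by (auto simp: nbrs_in_def card_gt_0_iff)
  qed
  then obtain u where u: "\<And>T. T \<in> P - {S} \<Longrightarrow> u T \<in> T \<and> (v, u T) \<in> parcs G" by metis
  have "inj_on u (P - {S})"
    using u disj by (intro inj_onI) (metis DiffD1 disjoint_iff)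
  moreover have "u ` (P - {S}) \<subseteq> {w \<in> pverts G - S. (v, w) \<in> parcs G}"
    using u disj[OF _ S] sub by fastforce
  ultimately have "card (P - {S}) \<le> nbrs_in G (pverts G - S) v"
    unfolding nbrs_in_def by (rule card_inj_on_le) (rule finite_nbrs[OF G])
  then show ?thesis using S fin by (simp add: card_Diff_singleton)
qed

text \<open>
  The partition numbers are suprema of sets of naturals, which are finite because a partition of
  \<open>V\<close> consists of subsets of \<open>V\<close>. Positivity excludes the value \<open>Sup {} = 0\<close>, so the supremum is
  an attained maximum.
\<close>
lemma Sup_card_partition_attained:
  assumes "finite V" and pos: "Sup {card P |P. partition_on V P \<and> Q P} > (0::nat)"
  obtains P where "partition_on V P" "Q P" "card P = Sup {card P |P. partition_on V P \<and> Q P}"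
proof -
  let ?C = "{card P |P. partition_on V P \<and> Q P}"
  have "?C \<subseteq> card ` Pow (Pow V)" by (auto simp: partition_on_def)
  then have "finite ?C" using assms(1) by (meson finite_Pow_iff finite_imageI finite_subset)
  moreover have "?C \<noteq> {}" using pos by (metis Sup_nat_empty less_irrefl)
  ultimately have "Sup ?C \<in> ?C" by (metis (no_types, lifting) Max_in Sup_nat_def)
  then show thesis using that by auto
qed

lemma global_partition_number_le:
  assumes G: "pair_graph G" and part: "partitionable_gd G k"
  shows "real (psi_gd G k) \<le> real (max_degree G) + 1 - isoperimetric_number G - real_of_int k"
proof -
  interpret pair_graph G by fact
  have pos: "psi_gd G k > 0" using part by (simp add: partitionable_gd_def)
  obtain P where P: "partition_on (pverts G) P" "\<forall>S\<in>P. global_defensive_alliance G k S"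
    and card: "card P = psi_gd G k"
    using Sup_card_partition_attained[OF pair_finite_verts pos[unfolded psi_gd_def]]
    unfolding psi_gd_def by blast
  obtain S where S: "S \<in> P" "2 * card S \<le> card (pverts G)"
    using small_part_of_partition[OF pair_finite_verts P(1)] part card
    unfolding partitionable_gd_def by auto
  have all: "defensive_alliance G k S" using P(2) S(1) by (simp add: global_defensive_alliance_def)
  then have sub: "S \<noteq> {}" "S \<subseteq> pverts G" by (auto simp: defensive_alliance_def)
  obtain v where v: "v \<in> S" "isoperimetric_number G \<le> real (nbrs_in G (pverts G - S) v)"
    using exists_vertex_isoperimetric[OF pair_finite_verts sub S(2)] by blast
  have "int (nbrs_in G S v) \<ge> int (nbrs_in G (pverts G - S) v) + k"
    using all v(1) by (auto simp: defensive_alliance_def)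
  moreover have "card P \<le> nbrs_in G (pverts G - S) v + 1"
    using P S(1) v(1)
    by (intro dominating_partition_nbrs_outside[OF G]) (auto simp: global_defensive_alliance_def)
  moreover have "nbrs_in G S v + nbrs_in G (pverts G - S) v \<le> max_degree G"
    using degree_le_max_degree[OF G] degree_eq_nbrs_in_add_nbrs_outside[OF G sub(2)] v(1) sub(2)
    by (metis subsetD)
  ultimately show ?thesis using v(2) card by linarith
qed

text \<open>
  Partitionability enters through the size of a minimum alliance: it is at most that of a small part,
  hence at most half of the vertices.
\<close>
lemma defensive_alliance_number_ge:
  assumes G: "pair_graph G" and part: "partitionable_d G k"
  shows "real (defensive_alliance_number G k) \<ge> isoperimetric_number G + real_of_int k + 1"
proof -
  interpret pair_graph G by fact
  have pos: "psi_d G k > 0" using part by (simp add: partitionable_d_def)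
  obtain P where P: "partition_on (pverts G) P" "\<forall>S\<in>P. defensive_alliance G k S"
    and card: "card P = psi_d G k"
    using Sup_card_partition_attained[OF pair_finite_verts pos[unfolded psi_d_def]]
    unfolding psi_d_def by blast
  obtain T where T: "T \<in> P" "2 * card T \<le> card (pverts G)"
    using small_part_of_partition[OF pair_finite_verts P(1)] part card
    unfolding partitionable_d_def by auto
  let ?C = "{card S |S. defensive_alliance G k S}"
  have "?C \<subseteq> card ` Pow (pverts G)" by (auto simp: defensive_alliance_def)
  then have fin: "finite ?C"
    using pair_finite_verts by (meson finite_Pow_iff finite_imageI finite_subset)
  have T_in: "card T \<in> ?C" using P(2) T(1) by blast
  then have "defensive_alliance_number G k \<in> ?C"
    unfolding defensive_alliance_number_def using fin by (intro Min_in) auto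
  then obtain S where S: "defensive_alliance G k S" "card S = defensive_alliance_number G k"
    by auto
  have "card S \<le> card T"
    unfolding S(2) defensive_alliance_number_def using fin T_in by (rule Min_le)
  then have small: "2 * card S \<le> card (pverts G)" using T(2) by simp
  have sub: "S \<noteq> {}" "S \<subseteq> pverts G" using S(1) by (auto simp: defensive_alliance_def)
  obtain v where v: "v \<in> S" "isoperimetric_number G \<le> real (nbrs_in G (pverts G - S) v)"
    using exists_vertex_isoperimetric[OF pair_finite_verts sub small] by blast
  have "int (nbrs_in G S v) \<ge> int (nbrs_in G (pverts G - S) v) + k"
    using S(1) v(1) by (auto simp: defensive_alliance_def)
  moreover have "nbrs_in G S v < card S"
    using sub(2) pair_finite_verts v(1) by (intro nbrs_in_less_card[OF G]) (auto intro: finite_subset)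
  ultimately show ?thesis using v(2) S(2) by linarith
qed

theorem theorem9:
  fixes G :: "'a pair_pre_digraph" and k :: int
  assumes "pair_graph G"
  shows "(partitionable_gd G k \<longrightarrow>
            real (psi_gd G k) \<le> real (max_degree G) + 1 - isoperimetric_number G - real_of_int k) \<and>
         (partitionable_d G k \<longrightarrow>
            real (defensive_alliance_number G k) \<ge> isoperimetric_number G + real_of_int k + 1)"
  using global_partition_number_le[OF assms] defensive_alliance_number_ge[OF assms] by blast

end
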